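(* Let $\mathcal T$ be an essentially small rigid tensor triangulated category. Then any pair of thick tensor ideals of $\mathcal T$ is commuting.
   Context: A tensor triangulated category $(\mathcal T,\otimes,\mathbf 1)$ is a triangulated category with a symmetric monoidal structure that is exact in each variable. It is rigid if there is an exact functor $D\colon\mathcal T^{\mathrm{op}}\to\mathcal T$ and a natural isomorphism $\mathrm{Hom}_{\mathcal T}(X\otimes Y,Z)\cong\mathrm{Hom}_{\mathcal T}(Y,DX\otimes Z)$ for all $X,Y,Z\in\mathcal T$. A thick tensor ideal is a thick subcategory $\mathcal U$ (full triangulated, closed under direct summands) such that $X\otimes U\in\mathcal U$ for all $X\in\mathcal T$ and $U\in\mathcal U$. A pair of thick subcategories $\mathcal U,\mathcal V$ is commuting if every morphism between an object of $\mathcal U$ and an object of $\mathcal V$ (in either direction) factors through an object of $\mathcal U\wedge\mathcal V=\mathcal U\cap\mathcal V$. *)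

theory Defs
  imports "HOL-Algebra.Group"
begin

section \<open>Categories, functors, natural isomorphisms\<close>

record ('o, 'm) cat =
  Ob :: "'o set"
  Ar :: "'m set"
  src :: "'m \<Rightarrow> 'o"
  tgt :: "'m \<Rightarrow> 'o"
  ident :: "'o \<Rightarrow> 'm"
  cmp :: "'m \<Rightarrow> 'm \<Rightarrow> 'm" (infixr "\<cdot>\<index>" 75)

text \<open>Composition is written in the usual order: \<open>g \<cdot> f\<close> means \<open>g\<close> after \<open>f\<close>.\<close>

definition Hom :: "('o, 'm, 'x) cat_scheme \<Rightarrow> 'o \<Rightarrow> 'o \<Rightarrow> 'm set" where
  "Hom C X Y = {f \<in> Ar C. src C f = X \<and> tgt C f = Y}"

locale category =
  fixes C :: "('o, 'm, 'x) cat_scheme" (structure)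
  assumes src_closed: "f \<in> Ar C \<Longrightarrow> src C f \<in> Ob C"
    and tgt_closed: "f \<in> Ar C \<Longrightarrow> tgt C f \<in> Ob C"
    and ident_closed: "X \<in> Ob C \<Longrightarrow> ident C X \<in> Hom C X X"
    and cmp_closed: "f \<in> Hom C X Y \<Longrightarrow> g \<in> Hom C Y Z \<Longrightarrow> g \<cdot> f \<in> Hom C X Z"
    and cmp_ident_left: "f \<in> Hom C X Y \<Longrightarrow> ident C Y \<cdot> f = f"
    and cmp_ident_right: "f \<in> Hom C X Y \<Longrightarrow> f \<cdot> ident C X = f"
    and cmp_assoc: "f \<in> Hom C W X \<Longrightarrow> g \<in> Hom C X Y \<Longrightarrow> h \<in> Hom C Y Z
      \<Longrightarrow> (h \<cdot> g) \<cdot> f = h \<cdot> (g \<cdot> f)"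

definition iso_arrow :: "('o, 'm, 'x) cat_scheme \<Rightarrow> 'o \<Rightarrow> 'o \<Rightarrow> 'm \<Rightarrow> bool" where
  "iso_arrow C X Y f \<longleftrightarrow> f \<in> Hom C X Y \<and>
     (\<exists>g \<in> Hom C Y X. g \<cdot>\<^bsub>C\<^esub> f = ident C X \<and> f \<cdot>\<^bsub>C\<^esub> g = ident C Y)"

definition isomorphic :: "('o, 'm, 'x) cat_scheme \<Rightarrow> 'o \<Rightarrow> 'o \<Rightarrow> bool" where
  "isomorphic C X Y \<longleftrightarrow> (\<exists>f. iso_arrow C X Y f)"

definition is_functor ::
  "('o, 'm, 'x) cat_scheme \<Rightarrow> ('p, 'n, 'y) cat_scheme \<Rightarrow> ('o \<Rightarrow> 'p) \<Rightarrow> ('m \<Rightarrow> 'n) \<Rightarrow> bool" where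
  "is_functor C D Fo Fm \<longleftrightarrow>
     (\<forall>X \<in> Ob C. Fo X \<in> Ob D) \<and>
     (\<forall>X \<in> Ob C. \<forall>Y \<in> Ob C. \<forall>f \<in> Hom C X Y. Fm f \<in> Hom D (Fo X) (Fo Y)) \<and>
     (\<forall>X \<in> Ob C. Fm (ident C X) = ident D (Fo X)) \<and>
     (\<forall>X \<in> Ob C. \<forall>Y \<in> Ob C. \<forall>Z \<in> Ob C. \<forall>f \<in> Hom C X Y. \<forall>g \<in> Hom C Y Z.
        Fm (g \<cdot>\<^bsub>C\<^esub> f) = Fm g \<cdot>\<^bsub>D\<^esub> Fm f)"

definition natural_iso ::
  "('o, 'm, 'x) cat_scheme \<Rightarrow> ('p, 'n, 'y) cat_scheme \<Rightarrow>
   ('o \<Rightarrow> 'p) \<Rightarrow> ('m \<Rightarrow> 'n) \<Rightarrow> ('o \<Rightarrow> 'p) \<Rightarrow> ('m \<Rightarrow> 'n) \<Rightarrow> ('o \<Rightarrow> 'n) \<Rightarrow> bool" where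
  "natural_iso C D Fo Fm Go Gm t \<longleftrightarrow>
     (\<forall>X \<in> Ob C. iso_arrow D (Fo X) (Go X) (t X)) \<and>
     (\<forall>X \<in> Ob C. \<forall>Y \<in> Ob C. \<forall>f \<in> Hom C X Y. t Y \<cdot>\<^bsub>D\<^esub> Fm f = Gm f \<cdot>\<^bsub>D\<^esub> t X)"

definition equivalent_categories ::
  "('o, 'm, 'x) cat_scheme \<Rightarrow> ('p, 'n, 'y) cat_scheme \<Rightarrow> bool" where
  "equivalent_categories C D \<longleftrightarrow>
     (\<exists>Fo Fm Go Gm t u. is_functor C D Fo Fm \<and> is_functor D C Go Gm \<and>
        natural_iso C C id id (Go \<circ> Fo) (Gm \<circ> Fm) t \<and>
        natural_iso D D (Fo \<circ> Go) (Fm \<circ> Gm) id id u)"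

text \<open>HOL has no built-in distinction between sets and classes.  Smallness is therefore relative
  to a type \<open>'s\<close> which plays the role of the universe: a small category is one whose objects and
  arrows are elements of \<open>'s\<close>.\<close>

definition essentially_small :: "'s itself \<Rightarrow> ('o, 'm, 'x) cat_scheme \<Rightarrow> bool" where
  "essentially_small (_ :: 's itself) C \<longleftrightarrow>
     (\<exists>S :: ('s, 's) cat. category S \<and> equivalent_categories S C)"

definition prod_cat ::
  "('o, 'm, 'x) cat_scheme \<Rightarrow> ('p, 'n, 'y) cat_scheme \<Rightarrow> ('o \<times> 'p, 'm \<times> 'n) cat" where
  "prod_cat C D =
     \<lparr>Ob = Ob C \<times> Ob D,
      Ar = Ar C \<times> Ar D,
      src = map_prod (src C) (src D),
      tgt = map_prod (tgt C) (tgt D),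
      ident = map_prod (ident C) (ident D),
      cmp = (\<lambda>g f. (fst g \<cdot>\<^bsub>C\<^esub> fst f, snd g \<cdot>\<^bsub>D\<^esub> snd f))\<rparr>"


section \<open>Additive categories\<close>

record ('o, 'm) additive_cat = "('o, 'm) cat" +
  hplus :: "'m \<Rightarrow> 'm \<Rightarrow> 'm" (infixl "\<oplus>\<index>" 65)
  hzero :: "'o \<Rightarrow> 'o \<Rightarrow> 'm"

definition Hom_group :: "('o, 'm, 'x) additive_cat_scheme \<Rightarrow> 'o \<Rightarrow> 'o \<Rightarrow> 'm monoid" where
  "Hom_group C X Y = \<lparr>carrier = Hom C X Y, mult = hplus C, one = hzero C X Y\<rparr>"

definition hneg :: "('o, 'm, 'x) additive_cat_scheme \<Rightarrow> 'm \<Rightarrow> 'm" where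
  "hneg C f = inv\<^bsub>Hom_group C (src C f) (tgt C f)\<^esub> f"

definition zero_object :: "('o, 'm, 'x) cat_scheme \<Rightarrow> 'o \<Rightarrow> bool" where
  "zero_object C Z \<longleftrightarrow> Z \<in> Ob C \<and>
     (\<forall>X \<in> Ob C. (\<exists>!f. f \<in> Hom C Z X) \<and> (\<exists>!f. f \<in> Hom C X Z))"

definition is_direct_sum ::
  "('o, 'm, 'x) additive_cat_scheme \<Rightarrow> 'o \<Rightarrow> 'o \<Rightarrow> 'o \<Rightarrow> bool" where
  "is_direct_sum C X Y S \<longleftrightarrow> X \<in> Ob C \<and> Y \<in> Ob C \<and> S \<in> Ob C \<and>
     (\<exists>i \<in> Hom C X S. \<exists>j \<in> Hom C Y S. \<exists>p \<in> Hom C S X. \<exists>q \<in> Hom C S Y.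
        p \<cdot>\<^bsub>C\<^esub> i = ident C X \<and> q \<cdot>\<^bsub>C\<^esub> j = ident C Y \<and>
        p \<cdot>\<^bsub>C\<^esub> j = hzero C Y X \<and> q \<cdot>\<^bsub>C\<^esub> i = hzero C X Y \<and>
        (i \<cdot>\<^bsub>C\<^esub> p) \<oplus>\<^bsub>C\<^esub> (j \<cdot>\<^bsub>C\<^esub> q) = ident C S)"

locale additive_category = category C
  for C :: "('o, 'm, 'x) additive_cat_scheme" (structure) +
  assumes Hom_comm_group: "X \<in> Ob C \<Longrightarrow> Y \<in> Ob C \<Longrightarrow> comm_group (Hom_group C X Y)"
    and cmp_plus_right: "f \<in> Hom C X Y \<Longrightarrow> f' \<in> Hom C X Y \<Longrightarrow> g \<in> Hom C Y Z
      \<Longrightarrow> g \<cdot> (f \<oplus> f') = (g \<cdot> f) \<oplus> (g \<cdot> f')"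
    and cmp_plus_left: "f \<in> Hom C X Y \<Longrightarrow> g \<in> Hom C Y Z \<Longrightarrow> g' \<in> Hom C Y Z
      \<Longrightarrow> (g \<oplus> g') \<cdot> f = (g \<cdot> f) \<oplus> (g' \<cdot> f)"
    and zero_object_exists: "\<exists>Z. zero_object C Z"
    and direct_sum_exists: "X \<in> Ob C \<Longrightarrow> Y \<in> Ob C \<Longrightarrow> \<exists>S. is_direct_sum C X Y S"

definition additive_functor ::
  "('o, 'm, 'x) additive_cat_scheme \<Rightarrow> ('p, 'n, 'y) additive_cat_scheme \<Rightarrow>
   ('o \<Rightarrow> 'p) \<Rightarrow> ('m \<Rightarrow> 'n) \<Rightarrow> bool" where
  "additive_functor C D Fo Fm \<longleftrightarrow> is_functor C D Fo Fm \<and>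
     (\<forall>X \<in> Ob C. \<forall>Y \<in> Ob C. \<forall>f \<in> Hom C X Y. \<forall>g \<in> Hom C X Y.
        Fm (f \<oplus>\<^bsub>C\<^esub> g) = Fm f \<oplus>\<^bsub>D\<^esub> Fm g)"


section \<open>Triangulated categories\<close>

text \<open>The suspension is only required to be a self-equivalence, not a strict automorphism.  The
  record carries a quasi-inverse (\<open>unshift\<close>) together with the unit and counit of the adjoint
  equivalence, since the opposite triangulated category is suspended by the quasi-inverse.
  A triangle \<open>X \<rightarrow> Y \<rightarrow> Z \<rightarrow> \<Sigma>X\<close> is represented by its three morphisms.\<close>

record ('o, 'm) tri_cat = "('o, 'm) additive_cat" +
  shift_ob :: "'o \<Rightarrow> 'o"
  shift_ar :: "'m \<Rightarrow> 'm"
  unshift_ob :: "'o \<Rightarrow> 'o"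
  unshift_ar :: "'m \<Rightarrow> 'm"
  shift_unit :: "'o \<Rightarrow> 'm"
  shift_counit :: "'o \<Rightarrow> 'm"
  dist :: "('m \<times> 'm \<times> 'm) set"

definition is_triangle ::
  "('o, 'm, 'x) tri_cat_scheme \<Rightarrow> 'o \<Rightarrow> 'o \<Rightarrow> 'o \<Rightarrow> 'm \<Rightarrow> 'm \<Rightarrow> 'm \<Rightarrow> bool" where
  "is_triangle C X Y Z f g h \<longleftrightarrow>
     f \<in> Hom C X Y \<and> g \<in> Hom C Y Z \<and> h \<in> Hom C Z (shift_ob C X)"

definition dist_triangle ::
  "('o, 'm, 'x) tri_cat_scheme \<Rightarrow> 'o \<Rightarrow> 'o \<Rightarrow> 'o \<Rightarrow> 'm \<Rightarrow> 'm \<Rightarrow> 'm \<Rightarrow> bool" where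
  "dist_triangle C X Y Z f g h \<longleftrightarrow> is_triangle C X Y Z f g h \<and> (f, g, h) \<in> dist C"

locale triangulated_category = additive_category C
  for C :: "('o, 'm, 'x) tri_cat_scheme" (structure) +
  assumes shift_additive_functor: "additive_functor C C (shift_ob C) (shift_ar C)"
    and unshift_functor: "is_functor C C (unshift_ob C) (unshift_ar C)"
    and shift_unit_iso: "natural_iso C C id id
      (unshift_ob C \<circ> shift_ob C) (unshift_ar C \<circ> shift_ar C) (shift_unit C)"
    and shift_counit_iso: "natural_iso C C
      (shift_ob C \<circ> unshift_ob C) (shift_ar C \<circ> unshift_ar C) id id (shift_counit C)"
    and shift_triangle_identity: "X \<in> Ob C \<Longrightarrow>
      shift_counit C (shift_ob C X) \<cdot> shift_ar C (shift_unit C X) = ident C (shift_ob C X)"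
    and unshift_triangle_identity: "X \<in> Ob C \<Longrightarrow>
      unshift_ar C (shift_counit C X) \<cdot> shift_unit C (unshift_ob C X) = ident C (unshift_ob C X)"
    and dist_is_triangle: "(f, g, h) \<in> dist C \<Longrightarrow> \<exists>X Y Z. is_triangle C X Y Z f g h"
    and TR1_iso: "dist_triangle C X Y Z f g h \<Longrightarrow> is_triangle C X' Y' Z' f' g' h' \<Longrightarrow>
      iso_arrow C X X' a \<Longrightarrow> iso_arrow C Y Y' b \<Longrightarrow> iso_arrow C Z Z' c \<Longrightarrow>
      b \<cdot> f = f' \<cdot> a \<Longrightarrow> c \<cdot> g = g' \<cdot> b \<Longrightarrow> shift_ar C a \<cdot> h = h' \<cdot> c \<Longrightarrow>
      dist_triangle C X' Y' Z' f' g' h'"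
    and TR1_ident: "X \<in> Ob C \<Longrightarrow> zero_object C Z \<Longrightarrow>
      dist_triangle C X X Z (ident C X) (hzero C X Z) (hzero C Z (shift_ob C X))"
    and TR1_cone: "f \<in> Hom C X Y \<Longrightarrow> \<exists>Z g h. dist_triangle C X Y Z f g h"
    and TR2: "is_triangle C X Y Z f g h \<Longrightarrow>
      dist_triangle C X Y Z f g h \<longleftrightarrow>
      dist_triangle C Y Z (shift_ob C X) g h (hneg C (shift_ar C f))"
    and TR3: "dist_triangle C X Y Z f g h \<Longrightarrow> dist_triangle C X' Y' Z' f' g' h' \<Longrightarrow>
      a \<in> Hom C X X' \<Longrightarrow> b \<in> Hom C Y Y' \<Longrightarrow> b \<cdot> f = f' \<cdot> a \<Longrightarrow>
      \<exists>c \<in> Hom C Z Z'. c \<cdot> g = g' \<cdot> b \<and> shift_ar C a \<cdot> h = h' \<cdot> c"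
    and TR4: "dist_triangle C X Y P f p1 d1 \<Longrightarrow>
      dist_triangle C X Z Q (g \<cdot> f) p2 d2 \<Longrightarrow>
      dist_triangle C Y Z R g p3 d3 \<Longrightarrow>
      \<exists>a b. dist_triangle C P Q R a b (shift_ar C p1 \<cdot> d3) \<and>
        a \<cdot> p1 = p2 \<cdot> g \<and> d2 \<cdot> a = d1 \<and>
        b \<cdot> p2 = p3 \<and> d3 \<cdot> b = shift_ar C f \<cdot> d2"

definition exact_functor ::
  "('o, 'm, 'x) tri_cat_scheme \<Rightarrow> ('p, 'n, 'y) tri_cat_scheme \<Rightarrow>
   ('o \<Rightarrow> 'p) \<Rightarrow> ('m \<Rightarrow> 'n) \<Rightarrow> bool" where
  "exact_functor C D Fo Fm \<longleftrightarrow> additive_functor C D Fo Fm \<and>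
     (\<exists>t. natural_iso C D (Fo \<circ> shift_ob C) (Fm \<circ> shift_ar C)
                          (shift_ob D \<circ> Fo) (shift_ar D \<circ> Fm) t \<and>
          (\<forall>X Y Z f g h. dist_triangle C X Y Z f g h \<longrightarrow>
             dist_triangle D (Fo X) (Fo Y) (Fo Z) (Fm f) (Fm g) (t X \<cdot>\<^bsub>D\<^esub> Fm h)))"

text \<open>The opposite category.  A distinguished triangle \<open>X \<rightarrow> Y \<rightarrow> Z \<rightarrow> \<Sigma>X\<close> with morphisms
  \<open>f\<close>, \<open>g\<close>, \<open>h\<close> gives the opposite triangle with morphisms \<open>g\<close>, \<open>f\<close>, \<open>k\<close>, where
  \<open>k : \<Sigma>\<^sup>-\<^sup>1Z \<rightarrow> X\<close> corresponds to \<open>\<Sigma>\<^sup>-\<^sup>1h\<close> under \<open>X \<cong> \<Sigma>\<^sup>-\<^sup>1\<Sigma>X\<close>.  The other common convention has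
  \<open>-k\<close> in place of \<open>k\<close>; the exact functors are the same, as one may replace the
  comparison isomorphism in \<open>exact_functor\<close> by its negative.\<close>

definition op_tri :: "('o, 'm, 'x) tri_cat_scheme \<Rightarrow> ('o, 'm) tri_cat" where
  "op_tri C =
     \<lparr>Ob = Ob C, Ar = Ar C, src = tgt C, tgt = src C, ident = ident C,
      cmp = (\<lambda>g f. f \<cdot>\<^bsub>C\<^esub> g),
      hplus = hplus C, hzero = (\<lambda>X Y. hzero C Y X),
      shift_ob = unshift_ob C, shift_ar = unshift_ar C,
      unshift_ob = shift_ob C, unshift_ar = shift_ar C,
      shift_unit = shift_counit C, shift_counit = shift_unit C,
      dist = {(g, f, k) | f g h k X Y Z. dist_triangle C X Y Z f g h \<and>
        k \<in> Hom C (unshift_ob C Z) X \<and> shift_unit C X \<cdot>\<^bsub>C\<^esub> k = unshift_ar C h}\<rparr>"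


section \<open>Tensor triangulated categories\<close>

record ('o, 'm) tt_cat = "('o, 'm) tri_cat" +
  tens_ob :: "'o \<Rightarrow> 'o \<Rightarrow> 'o" (infixr "\<otimes>\<^sub>o\<index>" 80)
  tens_ar :: "'m \<Rightarrow> 'm \<Rightarrow> 'm" (infixr "\<otimes>\<^sub>a\<index>" 80)
  tunit :: "'o"
  assoc :: "'o \<Rightarrow> 'o \<Rightarrow> 'o \<Rightarrow> 'm"
  lunit :: "'o \<Rightarrow> 'm"
  runit :: "'o \<Rightarrow> 'm"
  braid :: "'o \<Rightarrow> 'o \<Rightarrow> 'm"

locale symmetric_monoidal_category = category C
  for C :: "('o, 'm, 'x) tt_cat_scheme" (structure) +
  assumes tens_functor: "is_functor (prod_cat C C) C
      (\<lambda>(X, Y). X \<otimes>\<^sub>o Y) (\<lambda>(f, g). f \<otimes>\<^sub>a g)"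
    and tunit_closed: "tunit C \<in> Ob C"
    and assoc_iso: "natural_iso (prod_cat C (prod_cat C C)) C
      (\<lambda>(X, Y, Z). (X \<otimes>\<^sub>o Y) \<otimes>\<^sub>o Z) (\<lambda>(f, g, h). (f \<otimes>\<^sub>a g) \<otimes>\<^sub>a h)
      (\<lambda>(X, Y, Z). X \<otimes>\<^sub>o (Y \<otimes>\<^sub>o Z)) (\<lambda>(f, g, h). f \<otimes>\<^sub>a (g \<otimes>\<^sub>a h))
      (\<lambda>(X, Y, Z). assoc C X Y Z)"
    and lunit_iso: "natural_iso C C
      (\<lambda>X. tunit C \<otimes>\<^sub>o X) (\<lambda>f. ident C (tunit C) \<otimes>\<^sub>a f) id id (lunit C)"
    and runit_iso: "natural_iso C C
      (\<lambda>X. X \<otimes>\<^sub>o tunit C) (\<lambda>f. f \<otimes>\<^sub>a ident C (tunit C)) id id (runit C)"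
    and braid_iso: "natural_iso (prod_cat C C) C
      (\<lambda>(X, Y). X \<otimes>\<^sub>o Y) (\<lambda>(f, g). f \<otimes>\<^sub>a g)
      (\<lambda>(X, Y). Y \<otimes>\<^sub>o X) (\<lambda>(f, g). g \<otimes>\<^sub>a f)
      (\<lambda>(X, Y). braid C X Y)"
    and pentagon: "W \<in> Ob C \<Longrightarrow> X \<in> Ob C \<Longrightarrow> Y \<in> Ob C \<Longrightarrow> Z \<in> Ob C \<Longrightarrow>
      assoc C W X (Y \<otimes>\<^sub>o Z) \<cdot> assoc C (W \<otimes>\<^sub>o X) Y Z =
      (ident C W \<otimes>\<^sub>a assoc C X Y Z) \<cdot> assoc C W (X \<otimes>\<^sub>o Y) Z \<cdot> (assoc C W X Y \<otimes>\<^sub>a ident C Z)"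
    and unit_triangle: "X \<in> Ob C \<Longrightarrow> Y \<in> Ob C \<Longrightarrow>
      (ident C X \<otimes>\<^sub>a lunit C Y) \<cdot> assoc C X (tunit C) Y = runit C X \<otimes>\<^sub>a ident C Y"
    and hexagon: "X \<in> Ob C \<Longrightarrow> Y \<in> Ob C \<Longrightarrow> Z \<in> Ob C \<Longrightarrow>
      assoc C Y Z X \<cdot> braid C X (Y \<otimes>\<^sub>o Z) \<cdot> assoc C X Y Z =
      (ident C Y \<otimes>\<^sub>a braid C X Z) \<cdot> assoc C Y X Z \<cdot> (braid C X Y \<otimes>\<^sub>a ident C Z)"
    and braid_symmetric: "X \<in> Ob C \<Longrightarrow> Y \<in> Ob C \<Longrightarrow>
      braid C Y X \<cdot> braid C X Y = ident C (X \<otimes>\<^sub>o Y)"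

locale tensor_triangulated_category =
  triangulated_category C + symmetric_monoidal_category C
  for C :: "('o, 'm, 'x) tt_cat_scheme" (structure) +
  assumes tens_exact_right: "X \<in> Ob C \<Longrightarrow>
      exact_functor C C (\<lambda>Y. X \<otimes>\<^sub>o Y) (\<lambda>f. ident C X \<otimes>\<^sub>a f)"
    and tens_exact_left: "X \<in> Ob C \<Longrightarrow>
      exact_functor C C (\<lambda>Y. Y \<otimes>\<^sub>o X) (\<lambda>f. f \<otimes>\<^sub>a ident C X)"

text \<open>\<open>b X Y Z\<close> is the natural bijection \<open>Hom(X \<otimes> Y, Z) \<cong> Hom(Y, DX \<otimes> Z)\<close>; naturality is required
  in all three variables simultaneously.\<close>

definition rigid :: "('o, 'm, 'x) tt_cat_scheme \<Rightarrow> bool" where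
  "rigid C \<longleftrightarrow>
     (\<exists>Do Dm. exact_functor (op_tri C) C Do Dm \<and>
       (\<exists>b. (\<forall>X \<in> Ob C. \<forall>Y \<in> Ob C. \<forall>Z \<in> Ob C.
               bij_betw (b X Y Z) (Hom C (X \<otimes>\<^sub>o\<^bsub>C\<^esub> Y) Z) (Hom C Y (Do X \<otimes>\<^sub>o\<^bsub>C\<^esub> Z))) \<and>
            (\<forall>X \<in> Ob C. \<forall>X' \<in> Ob C. \<forall>Y \<in> Ob C. \<forall>Y' \<in> Ob C. \<forall>Z \<in> Ob C. \<forall>Z' \<in> Ob C.
               \<forall>x \<in> Hom C X' X. \<forall>y \<in> Hom C Y' Y. \<forall>z \<in> Hom C Z Z'.
               \<forall>f \<in> Hom C (X \<otimes>\<^sub>o\<^bsub>C\<^esub> Y) Z.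
                 b X' Y' Z' (z \<cdot>\<^bsub>C\<^esub> f \<cdot>\<^bsub>C\<^esub> (x \<otimes>\<^sub>a\<^bsub>C\<^esub> y)) =
                 (Dm x \<otimes>\<^sub>a\<^bsub>C\<^esub> z) \<cdot>\<^bsub>C\<^esub> b X Y Z f \<cdot>\<^bsub>C\<^esub> y)))"


section \<open>Thick tensor ideals and commuting pairs\<close>

text \<open>Full subcategories are represented by their sets of objects.\<close>

definition triangulated_subcategory :: "('o, 'm, 'x) tri_cat_scheme \<Rightarrow> 'o set \<Rightarrow> bool" where
  "triangulated_subcategory C U \<longleftrightarrow> U \<subseteq> Ob C \<and>
     (\<exists>Z \<in> U. zero_object C Z) \<and>
     (\<forall>X \<in> U. \<forall>Y \<in> Ob C. isomorphic C X Y \<longrightarrow> Y \<in> U) \<and>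
     (\<forall>X \<in> U. shift_ob C X \<in> U \<and> unshift_ob C X \<in> U) \<and>
     (\<forall>X Y Z f g h. dist_triangle C X Y Z f g h \<and> X \<in> U \<and> Y \<in> U \<longrightarrow> Z \<in> U)"

definition thick_subcategory :: "('o, 'm, 'x) tri_cat_scheme \<Rightarrow> 'o set \<Rightarrow> bool" where
  "thick_subcategory C U \<longleftrightarrow> triangulated_subcategory C U \<and>
     (\<forall>X Y S. is_direct_sum C X Y S \<and> S \<in> U \<longrightarrow> X \<in> U \<and> Y \<in> U)"

definition thick_tensor_ideal :: "('o, 'm, 'x) tt_cat_scheme \<Rightarrow> 'o set \<Rightarrow> bool" where
  "thick_tensor_ideal C U \<longleftrightarrow> thick_subcategory C U \<and>
     (\<forall>X \<in> Ob C. \<forall>A \<in> U. X \<otimes>\<^sub>o\<^bsub>C\<^esub> A \<in> U)"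

definition factors_through :: "('o, 'm, 'x) cat_scheme \<Rightarrow> 'm \<Rightarrow> 'o \<Rightarrow> bool" where
  "factors_through C f W \<longleftrightarrow>
     (\<exists>g \<in> Hom C (src C f) W. \<exists>h \<in> Hom C W (tgt C f). f = h \<cdot>\<^bsub>C\<^esub> g)"

definition commuting_pair :: "('o, 'm, 'x) tri_cat_scheme \<Rightarrow> 'o set \<Rightarrow> 'o set \<Rightarrow> bool" where
  "commuting_pair C U V \<longleftrightarrow> thick_subcategory C U \<and> thick_subcategory C V \<and>
     (\<forall>A \<in> U. \<forall>B \<in> V. \<forall>f \<in> Hom C A B \<union> Hom C B A. \<exists>W \<in> U \<inter> V. factors_through C f W)"

end

theory Submission
  imports Defs
begin

text \<open>Let \<open>D\<close> be the duality.  For a fixed object \<open>A\<close>, the bijection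
  \<open>Hom(A \<otimes> Y, Z) \<cong> Hom(Y, DA \<otimes> Z)\<close> makes \<open>A \<otimes> -\<close> left adjoint to \<open>DA \<otimes> -\<close>; write
  \<open>\<epsilon> : A \<otimes> (DA \<otimes> B) \<rightarrow> B\<close> for the counit at \<open>B\<close>.  A morphism \<open>f : A \<rightarrow> B\<close>, regarded as a morphism
  \<open>A \<otimes> 1 \<rightarrow> B\<close>, has a transpose \<open>g : 1 \<rightarrow> DA \<otimes> B\<close>, and is recovered from it as the composite
  \<open>A \<cong> A \<otimes> 1 \<rightarrow> A \<otimes> (DA \<otimes> B) \<rightarrow> B\<close>, where the middle arrow is \<open>id \<otimes> g\<close> and the last is \<open>\<epsilon>\<close>.
  So every morphism \<open>A \<rightarrow> B\<close> factors through \<open>A \<otimes> (DA \<otimes> B)\<close>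
  (\<open>rigid_factors_through_tensor\<close>).  This object has \<open>A\<close> and \<open>B\<close> among its tensor factors, so it
  lies in every tensor ideal containing \<open>A\<close> and in every tensor ideal containing \<open>B\<close>.\<close>

lemma (in symmetric_monoidal_category) tens_ob_closed:
  "X \<in> Ob C \<Longrightarrow> Y \<in> Ob C \<Longrightarrow> X \<otimes>\<^sub>o Y \<in> Ob C"
  using tens_functor by (auto simp: is_functor_def prod_cat_def)

lemma (in category) Hom_Ob:
  assumes "f \<in> Hom C X Y"
  shows "X \<in> Ob C" and "Y \<in> Ob C"
  using assms src_closed tgt_closed by (auto simp: Hom_def)

lemma (in symmetric_monoidal_category) tens_ar_Hom:
  assumes f: "f \<in> Hom C X Y" and g: "g \<in> Hom C X' Y'"
  shows "f \<otimes>\<^sub>a g \<in> Hom C (X \<otimes>\<^sub>o X') (Y \<otimes>\<^sub>o Y')"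
proof -
  have "(X, X') \<in> Ob (prod_cat C C)" "(Y, Y') \<in> Ob (prod_cat C C)"
    using Hom_Ob[OF f] Hom_Ob[OF g] by (simp_all add: prod_cat_def)
  moreover have "(f, g) \<in> Hom (prod_cat C C) (X, X') (Y, Y')"
    using f g by (simp add: prod_cat_def Hom_def)
  ultimately show ?thesis
    using tens_functor unfolding is_functor_def by fastforce
qed

lemma (in symmetric_monoidal_category) tens_ar_ident:
  assumes "X \<in> Ob C" and "Y \<in> Ob C"
  shows "ident C X \<otimes>\<^sub>a ident C Y = ident C (X \<otimes>\<^sub>o Y)"
  using tens_functor assms by (auto simp: is_functor_def prod_cat_def)

lemma (in symmetric_monoidal_category) braid_iso_arrow:
  assumes "X \<in> Ob C" and "Y \<in> Ob C"
  shows "iso_arrow C (X \<otimes>\<^sub>o Y) (Y \<otimes>\<^sub>o X) (braid C X Y)"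
proof -
  have "(X, Y) \<in> Ob (prod_cat C C)"
    using assms by (simp add: prod_cat_def)
  then show ?thesis
    using braid_iso unfolding natural_iso_def by fastforce
qed

text \<open>Ideals are only required to absorb tensoring on the left; the braiding supplies the right.\<close>

lemma (in symmetric_monoidal_category) thick_tensor_ideal_tensor_right:
  assumes U: "thick_tensor_ideal C U" and A: "A \<in> U" and X: "X \<in> Ob C"
  shows "A \<otimes>\<^sub>o X \<in> U"
proof -
  have tri: "triangulated_subcategory C U"
    using U by (simp add: thick_tensor_ideal_def thick_subcategory_def)
  then have sub: "U \<subseteq> Ob C"
    unfolding triangulated_subcategory_def by (elim conjE)
  from tri have iso_closed: "\<forall>X \<in> U. \<forall>Y \<in> Ob C. isomorphic C X Y \<longrightarrow> Y \<in> U"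
    unfolding triangulated_subcategory_def by (elim conjE)
  have A_Ob: "A \<in> Ob C"
    using sub A by (rule subsetD)
  have "isomorphic C (X \<otimes>\<^sub>o A) (A \<otimes>\<^sub>o X)"
    unfolding isomorphic_def using braid_iso_arrow[OF X A_Ob] by (rule exI)
  moreover have "X \<otimes>\<^sub>o A \<in> U"
    using U A X by (simp add: thick_tensor_ideal_def)
  ultimately show ?thesis
    using iso_closed tens_ob_closed[OF A_Ob X] by blast
qed

text \<open>The triangle identity for the adjunction between \<open>A \<otimes> -\<close> and \<open>DA \<otimes> -\<close> is obtained from naturality of the
  bijection in its middle variable: \<open>\<epsilon> \<circ> (id \<otimes> g)\<close> and \<open>f\<close> have the same transpose \<open>g\<close>.
  The object \<open>A'\<close> is \<open>DA\<close>.\<close>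

lemma (in tensor_triangulated_category) rigid_factors_through_tensor:
  assumes rigid: "rigid C" and A: "A \<in> Ob C"
  obtains A' where "A' \<in> Ob C"
    and "\<And>B f. f \<in> Hom C A B \<Longrightarrow> factors_through C f (A \<otimes>\<^sub>o (A' \<otimes>\<^sub>o B))"
proof -
  from rigid obtain Do Dm b where D: "exact_functor (op_tri C) C Do Dm"
    and bij: "\<forall>X \<in> Ob C. \<forall>Y \<in> Ob C. \<forall>Z \<in> Ob C.
      bij_betw (b X Y Z) (Hom C (X \<otimes>\<^sub>o Y) Z) (Hom C Y (Do X \<otimes>\<^sub>o Z))"
    and nat: "\<forall>X \<in> Ob C. \<forall>X' \<in> Ob C. \<forall>Y \<in> Ob C. \<forall>Y' \<in> Ob C. \<forall>Z \<in> Ob C. \<forall>Z' \<in> Ob C.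
      \<forall>x \<in> Hom C X' X. \<forall>y \<in> Hom C Y' Y. \<forall>z \<in> Hom C Z Z'. \<forall>f \<in> Hom C (X \<otimes>\<^sub>o Y) Z.
        b X' Y' Z' (z \<cdot> f \<cdot> (x \<otimes>\<^sub>a y)) = (Dm x \<otimes>\<^sub>a z) \<cdot> b X Y Z f \<cdot> y"
    unfolding rigid_def by (elim exE conjE)
  have DA: "Do A \<in> Ob C" and Dm_ident: "Dm (ident C A) = ident C (Do A)"
    using D A by (auto simp: exact_functor_def additive_functor_def is_functor_def op_tri_def)
  have "factors_through C f (A \<otimes>\<^sub>o (Do A \<otimes>\<^sub>o B))" if f: "f \<in> Hom C A B" for B f
  proof -
    let ?I = "tunit C" and ?H = "Do A \<otimes>\<^sub>o B"
    have I: "?I \<in> Ob C" and B: "B \<in> Ob C"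
      using tunit_closed Hom_Ob[OF f] by auto
    have H: "?H \<in> Ob C"
      using DA B by (rule tens_ob_closed)
    obtain r where \<rho>: "runit C A \<in> Hom C (A \<otimes>\<^sub>o ?I) A" and r: "r \<in> Hom C A (A \<otimes>\<^sub>o ?I)"
      and \<rho>r: "runit C A \<cdot> r = ident C A"
      using runit_iso A by (auto simp: natural_iso_def iso_arrow_def)
    have f\<rho>: "f \<cdot> runit C A \<in> Hom C (A \<otimes>\<^sub>o ?I) B"
      using \<rho> f by (rule cmp_closed)
    define g where "g = b A ?I B (f \<cdot> runit C A)"
    have g: "g \<in> Hom C ?I ?H"
      unfolding g_def using bij_betwE[OF bij[rule_format, OF A I B]] f\<rho> by blast
    obtain \<epsilon> where \<epsilon>: "\<epsilon> \<in> Hom C (A \<otimes>\<^sub>o ?H) B" and b\<epsilon>: "b A ?H B \<epsilon> = ident C ?H"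
      using bij_betw_imp_surj_on[OF bij[rule_format, OF A H B]] ident_closed[OF H] by (metis imageE)
    have Ag: "ident C A \<otimes>\<^sub>a g \<in> Hom C (A \<otimes>\<^sub>o ?I) (A \<otimes>\<^sub>o ?H)"
      using ident_closed[OF A] g by (rule tens_ar_Hom)
    have \<epsilon>Ag: "\<epsilon> \<cdot> (ident C A \<otimes>\<^sub>a g) \<in> Hom C (A \<otimes>\<^sub>o ?I) B"
      using Ag \<epsilon> by (rule cmp_closed)
    have "b A ?I B (\<epsilon> \<cdot> (ident C A \<otimes>\<^sub>a g))
        = b A ?I B (ident C B \<cdot> \<epsilon> \<cdot> (ident C A \<otimes>\<^sub>a g))"
      using cmp_ident_left[OF \<epsilon>Ag] by simp
    also have "\<dots> = (Dm (ident C A) \<otimes>\<^sub>a ident C B) \<cdot> b A ?H B \<epsilon> \<cdot> g"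
      by (rule nat[rule_format, OF A A H I B B ident_closed[OF A] g ident_closed[OF B] \<epsilon>])
    also have "\<dots> = g"
      using cmp_ident_left[OF g] by (simp add: Dm_ident tens_ar_ident[OF DA B] b\<epsilon>)
    finally have transpose: "\<epsilon> \<cdot> (ident C A \<otimes>\<^sub>a g) = f \<cdot> runit C A"
      using bij_betw_imp_inj_on[OF bij[rule_format, OF A I B]] \<epsilon>Ag f\<rho> unfolding g_def by (metis inj_onD)
    have "f = (f \<cdot> runit C A) \<cdot> r"
      using cmp_assoc[OF r \<rho> f] \<rho>r cmp_ident_right[OF f] by simp
    also have "\<dots> = \<epsilon> \<cdot> ((ident C A \<otimes>\<^sub>a g) \<cdot> r)"
      using cmp_assoc[OF r Ag \<epsilon>] transpose by simp
    finally show ?thesis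
      using f \<epsilon> cmp_closed[OF r Ag] by (auto simp: factors_through_def Hom_def)
  qed
  with DA show thesis by (rule that)
qed

theorem proposition4p2:
  fixes T :: "('o, 'm) tt_cat" and U V :: "'o set"
  assumes "tensor_triangulated_category T"
    and "rigid T"
    and "essentially_small TYPE('s) T"
    and "thick_tensor_ideal T U"
    and "thick_tensor_ideal T V"
  shows "commuting_pair T U V"
proof -
  interpret tensor_triangulated_category T by (rule assms(1))
  have factor: "\<exists>W \<in> P \<inter> Q. factors_through T f W"
    if P: "thick_tensor_ideal T P" and Q: "thick_tensor_ideal T Q"
      and A: "A \<in> P" and B: "B \<in> Q" and f: "f \<in> Hom T A B" for P Q A B f
  proof -
    obtain A' where A': "A' \<in> Ob T" and fact: "factors_through T f (A \<otimes>\<^sub>o\<^bsub>T\<^esub> (A' \<otimes>\<^sub>o\<^bsub>T\<^esub> B))"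
      using rigid_factors_through_tensor[OF assms(2) Hom_Ob(1)[OF f]] f by metis
    have "A \<otimes>\<^sub>o\<^bsub>T\<^esub> (A' \<otimes>\<^sub>o\<^bsub>T\<^esub> B) \<in> P"
      using P A tens_ob_closed[OF A' Hom_Ob(2)[OF f]] by (rule thick_tensor_ideal_tensor_right)
    moreover have "A \<otimes>\<^sub>o\<^bsub>T\<^esub> (A' \<otimes>\<^sub>o\<^bsub>T\<^esub> B) \<in> Q"
      using Q A' B Hom_Ob(1)[OF f] by (simp add: thick_tensor_ideal_def)
    ultimately show ?thesis using fact by blast
  qed
  have "\<exists>W \<in> U \<inter> V. factors_through T f W"
    if "A \<in> U" "B \<in> V" "f \<in> Hom T A B \<union> Hom T B A" for A B f
    using that factor[OF assms(4,5)] factor[OF assms(5,4)] by blast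
  then show ?thesis
    using assms(4,5) by (simp add: commuting_pair_def thick_tensor_ideal_def)
qed

end
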